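(* Let $\mathbf X_\psi$ be a triangle center, essentially different from the centroid $\mathbf X_2$, that is an invariant curve-generating center with respect to two triangle families $\mathbf\Psi_0$ and $\mathbf\Psi_1$. Then $\mathbf X_\psi$ is an invariant curve-generating center with respect to the concatenation $\mathbf\Psi_1\circ\mathbf\Psi_0$.
   Context: **Triangles and centers.** $\triangle$ is the set of non-degenerate triangles $\Delta=(\mathbf A,\mathbf B,\mathbf C)$ in $\mathbb R^2$, with side lengths $a=|\mathbf B\mathbf C|$, $b=|\mathbf C\mathbf A|$, $c=|\mathbf A\mathbf B|$. A triangle center function is a real function $\psi\not\equiv 0$ of $(a,b,c)$ that is homogeneous of some real degree and satisfies $\psi(a,b,c)=\psi(a,c,b)$. It defines the triangle center $\mathbf X_\psi=\frac{a\psi(a,b,c)\mathbf A+b\psi(b,c,a)\mathbf B+c\psi(c,a,b)\mathbf C}{a\psi(a,b,c)+b\psi(b,c,a)+c\psi(c,a,b)}$ whenever the denominator is nonzero. $\mathbf X_2=\frac13(\mathbf A+\mathbf B+\mathbf C)$ is the centroid. Two triangle centers are essentially different if they coincide only in equilateral triangles. **Triangle families.** A triangle family $\mathbf\Psi=(\Psi_1,\Psi_2,\Psi_3):\mathbb R\to\mathbb R^3$ satisfies $\Psi_1(t)+\Psi_2(t)+\Psi_3(t)\ne0$ for all $t$ and not $\Psi_1\equiv\Psi_2\equiv\Psi_3$. Applied to $\Delta$, it yields triangles $\Delta_t^{\mathbf\Psi}$ with vertices of barycentric coordinates $\mathbf A_t=[\Psi_1:\Psi_2:\Psi_3]$, $\mathbf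 B_t=[\Psi_3:\Psi_1:\Psi_2]$, $\mathbf C_t=[\Psi_2:\Psi_3:\Psi_1]$ (evaluated at $t$) with respect to $\mathbf A,\mathbf B,\mathbf C$. The concatenation of $\mathbf\Psi$ and $\tilde{\mathbf\Psi}$ is $$(\mathbf\Psi\circ\tilde{\mathbf\Psi})(t)=\big(\Psi_1\tilde\Psi_1+\Psi_2\tilde\Psi_3+\Psi_3\tilde\Psi_2,\ \Psi_1\tilde\Psi_2+\Psi_2\tilde\Psi_1+\Psi_3\tilde\Psi_3,\ \Psi_1\tilde\Psi_3+\Psi_2\tilde\Psi_2+\Psi_3\tilde\Psi_1\big)(t);$$ the triangle at parameter $t$ is the one obtained by applying $\mathbf\Psi(t)$ to $\Delta_t^{\tilde{\mathbf\Psi}}$. **Triangle curves.** $\mathbf X_\psi^{\mathbf\Psi}(t)$ is the center of $\Delta_t^{\mathbf\Psi}$ determined by $\psi$ (using the side lengths of $\Delta_t^{\mathbf\Psi}$); if $\Psi_1(t)=\Psi_2(t)=\Psi_3(t)$, the triangle degenerates to $\mathbf X_2$ and $\mathbf X_\psi^{\mathbf\Psi}(t)=\mathbf X_2$. Equilateral $\Delta$ are excluded throughout, and curves are considered where the center is defined. All $\Delta_t^{\mathbf\Psi}$ have centroid $\mathbf X_2$, and curves for different $\Delta$ are compared relative to $\mathbf X_2$. **Invariance.** $\mathbf X_\psi$ is an invariant curve-generating center with respect to $\mathbf\Psi$ if the curves $t\mapsto\mathbf X_\psi^{\mathbf\Psi}(t)$ for different $\Delta$ differ only by translation, rotation, scaling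 or reflection: there is a plane curve $l(t)\in\mathbb R^2$ independent of $\Delta$ and, for each $\Delta$, a linear map $S_\Delta$ of $\mathbb R^2$ composed of rotations, reflections and nonzero uniform scalings, with $\mathbf X_\psi^{\mathbf\Psi}(t)=\mathbf X_2+S_\Delta\,l(t)$ for all $t$.
   Formalization: The center is additionally assumed to depend continuously on the non-degenerate, non-equilateral triangle where it is defined (the claim fails for arbitrary center functions); invariance is read as including that the center is defined for all t. *)

theory Defs
  imports "HOL-Analysis.Analysis"
begin

type_synonym point = "real ^ 2"
type_synonym triangle = "point \<times> point \<times> point"

definition nondegenerate :: "triangle \<Rightarrow> bool" where
  "nondegenerate \<Delta> \<longleftrightarrow> (case \<Delta> of (A, B, C) \<Rightarrow> \<not> collinear {A, B, C})"

definition side_a :: "triangle \<Rightarrow> real" where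
  "side_a \<Delta> = (case \<Delta> of (A, B, C) \<Rightarrow> dist B C)"

definition side_b :: "triangle \<Rightarrow> real" where
  "side_b \<Delta> = (case \<Delta> of (A, B, C) \<Rightarrow> dist C A)"

definition side_c :: "triangle \<Rightarrow> real" where
  "side_c \<Delta> = (case \<Delta> of (A, B, C) \<Rightarrow> dist A B)"

definition equilateral :: "triangle \<Rightarrow> bool" where
  "equilateral \<Delta> \<longleftrightarrow> side_a \<Delta> = side_b \<Delta> \<and> side_b \<Delta> = side_c \<Delta>"

definition centroid :: "triangle \<Rightarrow> point" where
  "centroid \<Delta> = (case \<Delta> of (A, B, C) \<Rightarrow> (1 / 3) *\<^sub>R (A + B + C))"

definition triangle_sides :: "real \<Rightarrow> real \<Rightarrow> real \<Rightarrow> bool" where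
  "triangle_sides a b c \<longleftrightarrow>
     0 < a \<and> 0 < b \<and> 0 < c \<and> a < b + c \<and> b < c + a \<and> c < a + b"

(* A center function lives on the side lengths of non-degenerate triangles;
   its values elsewhere are irrelevant. *)
definition triangle_center_function :: "(real \<Rightarrow> real \<Rightarrow> real \<Rightarrow> real) \<Rightarrow> bool" where
  "triangle_center_function \<psi> \<longleftrightarrow>
     (\<exists>a b c. triangle_sides a b c \<and> \<psi> a b c \<noteq> 0) \<and>
     (\<exists>d::real. \<forall>s a b c. 0 < s \<longrightarrow> triangle_sides a b c \<longrightarrow>
        \<psi> (s * a) (s * b) (s * c) = s powr d * \<psi> a b c) \<and>
     (\<forall>a b c. triangle_sides a b c \<longrightarrow> \<psi> a b c = \<psi> a c b)"

definition bary_sum :: "real \<times> real \<times> real \<Rightarrow> real" where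
  "bary_sum w = (case w of (x, y, z) \<Rightarrow> x + y + z)"

definition bary_point :: "real \<times> real \<times> real \<Rightarrow> triangle \<Rightarrow> point" where
  "bary_point w \<Delta> = (case (w, \<Delta>) of ((x, y, z), (A, B, C)) \<Rightarrow>
     (1 / (x + y + z)) *\<^sub>R (x *\<^sub>R A + y *\<^sub>R B + z *\<^sub>R C))"

definition center_weights ::
    "(real \<Rightarrow> real \<Rightarrow> real \<Rightarrow> real) \<Rightarrow> triangle \<Rightarrow> real \<times> real \<times> real" where
  "center_weights \<psi> \<Delta> = (let a = side_a \<Delta>; b = side_b \<Delta>; c = side_c \<Delta> in
     (a * \<psi> a b c, b * \<psi> b c a, c * \<psi> c a b))"

definition center_defined :: "(real \<Rightarrow> real \<Rightarrow> real \<Rightarrow> real) \<Rightarrow> triangle \<Rightarrow> bool" where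
  "center_defined \<psi> \<Delta> \<longleftrightarrow> bary_sum (center_weights \<psi> \<Delta>) \<noteq> 0"

definition center :: "(real \<Rightarrow> real \<Rightarrow> real \<Rightarrow> real) \<Rightarrow> triangle \<Rightarrow> point" where
  "center \<psi> \<Delta> = bary_point (center_weights \<psi> \<Delta>) \<Delta>"

definition essentially_different_from_centroid ::
    "(real \<Rightarrow> real \<Rightarrow> real \<Rightarrow> real) \<Rightarrow> bool" where
  "essentially_different_from_centroid \<psi> \<longleftrightarrow>
     (\<forall>\<Delta>. nondegenerate \<Delta> \<and> center_defined \<psi> \<Delta> \<and> center \<psi> \<Delta> = centroid \<Delta>
        \<longrightarrow> equilateral \<Delta>)"

(* The center depends continuously on the triangle, equilateral triangles being excluded. *)
definition continuous_center :: "(real \<Rightarrow> real \<Rightarrow> real \<Rightarrow> real) \<Rightarrow> bool" where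
  "continuous_center \<psi> \<longleftrightarrow>
     continuous_on {\<Delta>. nondegenerate \<Delta> \<and> \<not> equilateral \<Delta> \<and> center_defined \<psi> \<Delta>} (center \<psi>)"

type_synonym family = "real \<Rightarrow> real \<times> real \<times> real"

definition all_equal :: "real \<times> real \<times> real \<Rightarrow> bool" where
  "all_equal w \<longleftrightarrow> (case w of (x, y, z) \<Rightarrow> x = y \<and> y = z)"

definition triangle_family :: "family \<Rightarrow> bool" where
  "triangle_family \<Psi> \<longleftrightarrow>
     (\<forall>t. bary_sum (\<Psi> t) \<noteq> 0) \<and> \<not> (\<forall>t. all_equal (\<Psi> t))"

definition family_triangle :: "family \<Rightarrow> triangle \<Rightarrow> real \<Rightarrow> triangle" where
  "family_triangle \<Psi> \<Delta> t = (case \<Psi> t of (x, y, z) \<Rightarrow>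
     (bary_point (x, y, z) \<Delta>, bary_point (z, x, y) \<Delta>, bary_point (y, z, x) \<Delta>))"

definition concatenation :: "family \<Rightarrow> family \<Rightarrow> family" where
  "concatenation \<Psi> \<Psi>' = (\<lambda>t. case (\<Psi> t, \<Psi>' t) of ((x, y, z), (x', y', z')) \<Rightarrow>
     (x * x' + y * z' + z * y', x * y' + y * x' + z * z', x * z' + y * y' + z * x'))"

definition curve_defined ::
    "(real \<Rightarrow> real \<Rightarrow> real \<Rightarrow> real) \<Rightarrow> family \<Rightarrow> triangle \<Rightarrow> real \<Rightarrow> bool" where
  "curve_defined \<psi> \<Psi> \<Delta> t \<longleftrightarrow>
     all_equal (\<Psi> t) \<or> center_defined \<psi> (family_triangle \<Psi> \<Delta> t)"

definition triangle_curve ::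
    "(real \<Rightarrow> real \<Rightarrow> real \<Rightarrow> real) \<Rightarrow> family \<Rightarrow> triangle \<Rightarrow> real \<Rightarrow> point" where
  "triangle_curve \<psi> \<Psi> \<Delta> t =
     (if all_equal (\<Psi> t) then centroid \<Delta> else center \<psi> (family_triangle \<Psi> \<Delta> t))"

(* In the plane, the orthogonal matrices of determinant -1 (rotoinversions) are exactly
   the reflections in lines through the origin. *)
inductive linear_similarity :: "(point \<Rightarrow> point) \<Rightarrow> bool" where
  rotation: "rotation_matrix Q \<Longrightarrow> linear_similarity (\<lambda>v. Q *v v)"
| reflection: "rotoinversion_matrix Q \<Longrightarrow> linear_similarity (\<lambda>v. Q *v v)"
| scaling: "k \<noteq> 0 \<Longrightarrow> linear_similarity (\<lambda>v. k *\<^sub>R v)"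
| composition: "linear_similarity S \<Longrightarrow> linear_similarity T \<Longrightarrow> linear_similarity (S \<circ> T)"

(* The equation is required for all t; in particular the center has to be defined
   along the whole curve. *)
definition invariant_curve_generating ::
    "(real \<Rightarrow> real \<Rightarrow> real \<Rightarrow> real) \<Rightarrow> family \<Rightarrow> bool" where
  "invariant_curve_generating \<psi> \<Psi> \<longleftrightarrow>
     (\<exists>l :: real \<Rightarrow> point. \<forall>\<Delta>. nondegenerate \<Delta> \<and> \<not> equilateral \<Delta> \<longrightarrow>
        (\<exists>S. linear_similarity S \<and>
          (\<forall>t. curve_defined \<psi> \<Psi> \<Delta> t \<and>
               triangle_curve \<psi> \<Psi> \<Delta> t = centroid \<Delta> + S (l t))))"

end

theory Submission
  imports Defs
begin

text \<open>
  Identify the plane with \<open>\<complex>\<close>, let \<open>\<omega>\<close> be a primitive cube root of unity, and write a triangle as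
  \<open>g + u + v\<close>, \<open>g + \<omega>u + \<omega>\<^sup>2v\<close>, \<open>g + \<omega>\<^sup>2u + \<omega>v\<close>, where \<open>g\<close> is the centroid.  A triangle family
  acts by real circulant matrices, which this discrete Fourier transform diagonalises: at time \<open>t\<close>
  the family multiplies \<open>u\<close> by a complex number \<open>\<lambda>(t)\<close> and \<open>v\<close> by its conjugate; the result is
  denoted by \<open>\<lambda>(t)\<Delta>\<close>.
  Concatenation of families multiplies the numbers \<open>\<lambda>(t)\<close>, so all families commute.  The triangle
  is nondegenerate iff \<open>|u| \<noteq> |v|\<close> and equilateral iff \<open>u = 0\<close> or \<open>v = 0\<close>; both
  conditions are preserved when \<open>\<lambda>(t) \<noteq> 0\<close>.

  Let \<open>Y(\<Delta>)\<close> be the center relative to the centroid; it never vanishes on the triangles considered.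
  Fix \<open>\<mu> = \<lambda>(t\<^sub>0) \<noteq> 0\<close>.  Invariance says that, for each \<open>t\<close>, the quotient
  \<open>Y(\<lambda>(t)\<Delta>) / Y(\<mu>\<Delta>)\<close> is \<open>q\<close> or its conjugate, with \<open>q\<close> independent of \<open>\<Delta>\<close>; the choice depends
  on whether the similarity of \<open>\<Delta>\<close> preserves orientation.  The quotient is continuous in \<open>\<Delta>\<close>,
  and the positively oriented nonequilateral triangles, \<open>0 < |v| < |u|\<close>, form a connected set, so on
  them the quotient is a constant \<open>c(t)\<close> (lemma \<open>invariant_imp_constant_ratio\<close>).
  Applying this to the two families in turn, with commutation in between, gives
  \<open>Y(\<lambda>\<^sub>1(t)\<lambda>\<^sub>0(t)\<Delta>) = c\<^sub>1(t) c\<^sub>0(t) Y(\<mu>\<^sub>0\<mu>\<^sub>1\<Delta>)\<close>: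
  the curve of the concatenation is a rotated and scaled copy of \<open>c\<^sub>1 c\<^sub>0\<close>.
  For a negatively oriented triangle the mirror image is positively oriented, and the curve is a
  rotated and scaled copy of the conjugate of \<open>c\<^sub>1 c\<^sub>0\<close>.
\<close>

section \<open>Complex coordinates and similarities of the plane\<close>

definition plane_point :: "complex \<Rightarrow> point" where
  "plane_point z = vector [Re z, Im z]"

definition plane_coord :: "point \<Rightarrow> complex" where
  "plane_coord p = Complex (p $ 1) (p $ 2)"

lemma plane_coord_point [simp]: "plane_coord (plane_point z) = z"
  by (simp add: plane_coord_def plane_point_def)

lemma plane_point_coord [simp]: "plane_point (plane_coord p) = p"
  by (simp add: plane_coord_def plane_point_def vec_eq_iff forall_2)

lemma plane_point_eq_iff [simp]: "plane_point x = plane_point y \<longleftrightarrow> x = y"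
  by (metis plane_coord_point)

lemma linear_plane_point: "linear plane_point"
  by (rule linearI) (simp_all add: plane_point_def vec_eq_iff forall_2)

lemma linear_plane_coord: "linear plane_coord"
  by (rule linearI) (simp_all add: plane_coord_def complex_eq_iff)

lemmas plane_point_add = linear_add [OF linear_plane_point]
  and plane_point_diff = linear_diff [OF linear_plane_point]
  and plane_point_scaleR = linear_scale [OF linear_plane_point]
  and plane_point_0 = linear_0 [OF linear_plane_point]

lemma dist_plane_point: "dist (plane_point x) (plane_point y) = cmod (x - y)"
proof -
  have "norm (plane_point z) = cmod z" for z
    by (simp add: plane_point_def norm_vec_def L2_set_def sum_2 cmod_def)
  then show ?thesis
    by (metis dist_norm plane_point_diff)
qed

text \<open>Twice the signed area of the triangle, up to sign, is the imaginary part below.\<close>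

lemma collinear_plane_point_iff:
  "collinear {plane_point x, plane_point y, plane_point z} \<longleftrightarrow> Im ((z - y) * cnj (x - y)) = 0"
proof -
  have *: "(p = 0 \<or> q = 0 \<or> (\<exists>r. q = r *\<^sub>R p)) \<longleftrightarrow> Im (q * cnj p) = 0" for p q :: complex
  proof
    assume "p = 0 \<or> q = 0 \<or> (\<exists>r. q = r *\<^sub>R p)"
    then show "Im (q * cnj p) = 0" by auto
  next
    assume im: "Im (q * cnj p) = 0"
    show "p = 0 \<or> q = 0 \<or> (\<exists>r. q = r *\<^sub>R p)"
    proof (cases "p = 0")
      case False
      have "q * (p * cnj p) = (q * cnj p) * p" by simp
      moreover have "q * cnj p = of_real (Re (q * cnj p))"
        using im by (simp add: complex_eq_iff)
      ultimately have "q * of_real ((cmod p)\<^sup>2) = of_real (Re (q * cnj p)) * p"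
        by (metis complex_norm_square)
      then have "q = (Re (q * cnj p) / (cmod p)\<^sup>2) *\<^sub>R p"
        using False by (simp add: scaleR_conv_of_real divide_simps)
      then show ?thesis by blast
    qed simp
  qed
  have "collinear {plane_point x, plane_point y, plane_point z} \<longleftrightarrow>
      collinear {0, plane_point (x - y), plane_point (z - y)}"
    unfolding plane_point_diff by (rule collinear_3) simp
  also have "\<dots> \<longleftrightarrow> x - y = 0 \<or> z - y = 0 \<or> (\<exists>r. z - y = r *\<^sub>R (x - y))"
    unfolding collinear_lemma by (simp flip: plane_point_scaleR plane_point_0)
  finally show ?thesis unfolding * .
qed

text \<open>
  Multiplications by nonzero complex numbers, together with their composites with conjugation,
  form a group that contains all the generators of the similarities.
\<close>

lemma linear_similarity_plane_cases:
  assumes "linear_similarity S"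
  shows "\<exists>k. k \<noteq> 0 \<and> ((\<forall>z. S (plane_point z) = plane_point (k * z)) \<or>
                       (\<forall>z. S (plane_point z) = plane_point (k * cnj z)))"
  using assms
proof (induction rule: linear_similarity.induct)
  case (rotation Q)
  then have "Q$1$1 * Q$1$1 + Q$2$1 * Q$2$1 = 1" "Q$1$1 * Q$1$2 + Q$2$1 * Q$2$2 = 0"
    "Q$1$2 * Q$1$2 + Q$2$2 * Q$2$2 = 1" "Q$1$1 * Q$2$2 - Q$1$2 * Q$2$1 = 1"
    by (auto simp: rotation_matrix_def orthogonal_matrix matrix_matrix_mult_def vec_eq_iff
        forall_2 sum_2 transpose_def mat_def det_2)
  then have "Q$2$2 = Q$1$1" "Q$1$2 = - Q$2$1" by algebra+
  then have "\<forall>z. Q *v plane_point z = plane_point (Complex (Q$1$1) (Q$2$1) * z)"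
    by (simp add: vec_eq_iff forall_2 matrix_vector_mult_def sum_2 plane_point_def algebra_simps)
  moreover have "Complex (Q$1$1) (Q$2$1) \<noteq> 0"
    using \<open>Q$1$1 * Q$1$1 + Q$2$1 * Q$2$1 = 1\<close> by (auto simp: complex_eq_iff)
  ultimately show ?case by blast
next
  case (reflection Q)
  then have "Q$1$1 * Q$1$1 + Q$2$1 * Q$2$1 = 1" "Q$1$1 * Q$1$2 + Q$2$1 * Q$2$2 = 0"
    "Q$1$2 * Q$1$2 + Q$2$2 * Q$2$2 = 1" "Q$1$1 * Q$2$2 - Q$1$2 * Q$2$1 = -1"
    by (auto simp: rotoinversion_matrix_def orthogonal_matrix matrix_matrix_mult_def vec_eq_iff
        forall_2 sum_2 transpose_def mat_def det_2)
  then have "Q$2$2 = - Q$1$1" "Q$1$2 = Q$2$1" by algebra+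
  then have "\<forall>z. Q *v plane_point z = plane_point (Complex (Q$1$1) (Q$2$1) * cnj z)"
    by (simp add: vec_eq_iff forall_2 matrix_vector_mult_def sum_2 plane_point_def algebra_simps)
  moreover have "Complex (Q$1$1) (Q$2$1) \<noteq> 0"
    using \<open>Q$1$1 * Q$1$1 + Q$2$1 * Q$2$1 = 1\<close> by (auto simp: complex_eq_iff)
  ultimately show ?case by blast
next
  case (scaling r)
  then show ?case
    by (intro exI [of _ "of_real r"]) (simp add: plane_point_def vec_eq_iff forall_2)
next
  case (composition S T)
  then obtain k m where km: "k \<noteq> 0" "m \<noteq> 0"
    and S: "(\<forall>z. S (plane_point z) = plane_point (k * z)) \<or> (\<forall>z. S (plane_point z) = plane_point (k * cnj z))"
    and T: "(\<forall>z. T (plane_point z) = plane_point (m * z)) \<or> (\<forall>z. T (plane_point z) = plane_point (m * cnj z))"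
    by blast
  show ?case
  proof (cases "\<forall>z. S (plane_point z) = plane_point (k * z)")
    case True
    then show ?thesis using T km by (intro exI [of _ "k * m"]) (auto simp: mult.assoc)
  next
    case False
    with S have "\<forall>z. S (plane_point z) = plane_point (k * cnj z)" by blast
    then show ?thesis using T km by (intro exI [of _ "k * cnj m"]) (auto simp: mult.assoc)
  qed
qed

text \<open>Polar decomposition of \<open>k\<close>: a rotation followed by scaling with \<open>|k|\<close>.\<close>

lemma linear_similarity_mult:
  assumes "k \<noteq> 0"
  shows "linear_similarity (\<lambda>p. plane_point (k * plane_coord p))"
proof -
  define q where "q = k / of_real (cmod k)"
  define Q :: "real^2^2" where "Q = vector [vector [Re q, - Im q], vector [Im q, Re q]]"
  have "cmod q = 1" using assms by (simp add: q_def norm_divide)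
  then have "Re q * Re q + Im q * Im q = 1"
    by (metis cmod_power2 one_power2 power2_eq_square)
  then have "rotation_matrix Q"
    by (simp add: rotation_matrix_def orthogonal_matrix matrix_matrix_mult_def vec_eq_iff
        forall_2 sum_2 transpose_def mat_def det_2 Q_def algebra_simps)
  then have "linear_similarity ((\<lambda>v. cmod k *\<^sub>R v) \<circ> (\<lambda>v. Q *v v))"
    using assms by (intro linear_similarity.intros) auto
  also have "(\<lambda>v. cmod k *\<^sub>R v) \<circ> (\<lambda>v. Q *v v) = (\<lambda>p. plane_point (k * plane_coord p))"
  proof
    fix p
    have "Q *v p = plane_point (q * plane_coord p)"
      by (simp add: vec_eq_iff forall_2 matrix_vector_mult_def sum_2 plane_point_def
          plane_coord_def Q_def algebra_simps)
    moreover have "k = of_real (cmod k) * q" using assms by (simp add: q_def)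
    ultimately show "((\<lambda>v. cmod k *\<^sub>R v) \<circ> (\<lambda>v. Q *v v)) p = plane_point (k * plane_coord p)"
      by (metis comp_apply mult.assoc plane_point_scaleR scaleR_conv_of_real)
  qed
  finally show ?thesis .
qed

lemma linear_similarity_mult_cnj:
  assumes "k \<noteq> 0"
  shows "linear_similarity (\<lambda>p. plane_point (k * cnj (plane_coord p)))"
proof -
  define Q :: "real^2^2" where "Q = vector [vector [1, 0], vector [0, -1]]"
  have "rotoinversion_matrix Q"
    by (simp add: rotoinversion_matrix_def orthogonal_matrix matrix_matrix_mult_def vec_eq_iff
        forall_2 sum_2 transpose_def mat_def det_2 Q_def)
  then have "linear_similarity ((\<lambda>p. plane_point (k * plane_coord p)) \<circ> (\<lambda>v. Q *v v))"
    using linear_similarity_mult [OF assms] by (intro linear_similarity.intros) auto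
  also have "(\<lambda>p. plane_point (k * plane_coord p)) \<circ> (\<lambda>v. Q *v v) =
      (\<lambda>p. plane_point (k * cnj (plane_coord p)))"
    by (simp add: fun_eq_iff vec_eq_iff forall_2 matrix_vector_mult_def sum_2 plane_point_def
          plane_coord_def Q_def algebra_simps)
  finally show ?thesis .
qed

section \<open>Triangles and families in Fourier coordinates\<close>

definition omega :: complex where
  "omega = Complex (- 1 / 2) (sqrt 3 / 2)"

lemma omega_square: "omega * omega = cnj omega"
  and omega_power2: "omega\<^sup>2 = - 1 - omega"
  and cnj_omega: "cnj omega = - 1 - omega"
  by (simp_all add: omega_def complex_eq_iff power2_eq_square)

text \<open>
  The vertices form a function on the cyclic group of order three; \<open>g\<close>, \<open>u\<close>, \<open>v\<close> are its Fourier
  coefficients. The part \<open>u\<close> is a positively, the part \<open>v\<close> a negatively oriented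
  equilateral triangle.
\<close>

definition fourier_triangle :: "complex \<Rightarrow> complex \<Rightarrow> complex \<Rightarrow> triangle" where
  "fourier_triangle g u v =
     (plane_point (g + u + v),
      plane_point (g + omega * u + cnj omega * v),
      plane_point (g + cnj omega * u + omega * v))"

lemma fourier_triangle_exhaust:
  obtains g u v where "\<Delta> = fourier_triangle g u v"
proof -
  obtain A B C where \<Delta>: "\<Delta> = (plane_point A, plane_point B, plane_point C)"
    by (metis plane_point_coord surj_pair)
  have "\<Delta> = fourier_triangle ((A + B + C) / 3) ((A + cnj omega * B + omega * C) / 3)
               ((A + omega * B + cnj omega * C) / 3)"
    unfolding \<Delta> fourier_triangle_def cnj_omega
    by (simp add: field_simps flip: power2_eq_square) (simp add: omega_power2 algebra_simps)
  then show thesis by (rule that)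
qed

lemma centroid_fourier_triangle: "centroid (fourier_triangle g u v) = plane_point g"
proof -
  have "(1 / 3) *\<^sub>R ((g + u + v) + (g + omega * u + cnj omega * v) + (g + cnj omega * u + omega * v)) = g"
    by (simp add: cnj_omega algebra_simps scaleR_conv_of_real)
  then show ?thesis
    unfolding centroid_def fourier_triangle_def
    by (simp only: prod.case flip: plane_point_add plane_point_scaleR)
qed

lemma fourier_triangle_edges:
  "(g + omega * u + cnj omega * v) - (g + cnj omega * u + omega * v) =
     (omega - cnj omega) * (u - v)"
  "(g + cnj omega * u + omega * v) - (g + u + v) =
     (omega - cnj omega) * (omega * (u - omega * v))"
  "(g + u + v) - (g + omega * u + cnj omega * v) =
     (omega - cnj omega) * (cnj omega * (u - cnj omega * v))"
  unfolding cnj_omega by (insert omega_power2, algebra+)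

text \<open>The signed area is proportional to \<open>|u|\<^sup>2 - |v|\<^sup>2\<close>: the mixed terms add up to a real number.\<close>

lemma nondegenerate_fourier_triangle:
  "nondegenerate (fourier_triangle g u v) \<longleftrightarrow> cmod u \<noteq> cmod v"
proof -
  define w where "w = cnj omega * (u * cnj v)"
  have "(v - u) * cnj (cnj omega * (u - cnj omega * v)) =
      (w + cnj w) - (omega * (u * cnj u) + cnj omega * (v * cnj v))"
    unfolding w_def omega_square [symmetric] by (simp add: algebra_simps omega_square)
  also have "Im \<dots> = - (sqrt 3 / 2) * ((cmod u)\<^sup>2 - (cmod v)\<^sup>2)"
    unfolding complex_norm_square [symmetric] by (simp add: omega_def algebra_simps)
  finally have "Im ((v - u) * cnj (cnj omega * (u - cnj omega * v))) =
      - (sqrt 3 / 2) * ((cmod u)\<^sup>2 - (cmod v)\<^sup>2)" .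
  moreover have "((g + cnj omega * u + omega * v) - (g + omega * u + cnj omega * v)) *
      cnj ((g + u + v) - (g + omega * u + cnj omega * v)) =
      of_real ((cmod (omega - cnj omega))\<^sup>2) * ((v - u) * cnj (cnj omega * (u - cnj omega * v)))"
    unfolding fourier_triangle_edges(3) complex_norm_square
    by (simp add: algebra_simps)
  moreover have "(cmod (omega - cnj omega))\<^sup>2 = 3"
    by (simp add: cmod_power2 omega_def)
  ultimately have "Im (((g + cnj omega * u + omega * v) - (g + omega * u + cnj omega * v)) *
           cnj ((g + u + v) - (g + omega * u + cnj omega * v)))
        = - (3 * (sqrt 3 / 2)) * ((cmod u)\<^sup>2 - (cmod v)\<^sup>2)"
    by simp
  then show ?thesis
    unfolding nondegenerate_def fourier_triangle_def
    by (simp add: collinear_plane_point_iff)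
qed

text \<open>
  With \<open>p\<close> and \<open>q\<close> the real and imaginary part of \<open>u * cnj v\<close>, the squared side lengths differ only by
  linear forms in \<open>p\<close> and \<open>q\<close>, so equal sides force \<open>u * cnj v = 0\<close>.
\<close>

lemma equilateral_fourier_triangle:
  "equilateral (fourier_triangle g u v) \<longleftrightarrow> u = 0 \<or> v = 0"
proof -
  let ?A = "g + u + v" and ?B = "g + omega * u + cnj omega * v"
    and ?C = "g + cnj omega * u + omega * v"
  define p where "p = Re u * Re v + Im u * Im v"
  define q where "q = Im u * Re v - Re u * Im v"
  have unit: "cmod omega = 1"
    by (simp add: cmod_def omega_def power_divide)
  have root3: "(cmod (omega - cnj omega))\<^sup>2 = 3"
    by (simp add: cmod_power2 omega_def)
  have expand: "(cmod (u - w * v))\<^sup>2 = (cmod u)\<^sup>2 + (cmod v)\<^sup>2 - 2 * (Re w * p + Im w * q)"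
    if "cmod w = 1" for w
  proof -
    have "(Re w)\<^sup>2 + (Im w)\<^sup>2 = 1"
      using that by (metis cmod_power2 one_power2)
    moreover have "(cmod (u - w * v))\<^sup>2 = (cmod u)\<^sup>2 + ((Re w)\<^sup>2 + (Im w)\<^sup>2) * (cmod v)\<^sup>2
        - 2 * (Re w * p + Im w * q)"
      unfolding cmod_power2 p_def q_def by (simp add: power2_eq_square algebra_simps)
    ultimately show ?thesis by simp
  qed
  have side: "(cmod ((omega - cnj omega) * (e * (u - w * v))))\<^sup>2 =
      3 * ((cmod u)\<^sup>2 + (cmod v)\<^sup>2 - 2 * (Re w * p + Im w * q))"
    if "cmod e = 1" "cmod w = 1" for e w
    by (simp only: norm_mult power_mult_distrib root3 expand that) simp
  have a: "(cmod (?B - ?C))\<^sup>2 = 3 * ((cmod u)\<^sup>2 + (cmod v)\<^sup>2 - 2 * p)"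
    unfolding fourier_triangle_edges using side [of 1 1] by simp
  have b: "(cmod (?C - ?A))\<^sup>2 = 3 * ((cmod u)\<^sup>2 + (cmod v)\<^sup>2 + p - sqrt 3 * q)"
    unfolding fourier_triangle_edges using side [of omega omega] unit by (simp add: omega_def)
  have c: "(cmod (?A - ?B))\<^sup>2 = 3 * ((cmod u)\<^sup>2 + (cmod v)\<^sup>2 + p + sqrt 3 * q)"
    unfolding fourier_triangle_edges using side [of "cnj omega" "cnj omega"] unit by (simp add: omega_def)
  have "equilateral (fourier_triangle g u v) \<longleftrightarrow>
      (cmod (?B - ?C))\<^sup>2 = (cmod (?C - ?A))\<^sup>2 \<and> (cmod (?C - ?A))\<^sup>2 = (cmod (?A - ?B))\<^sup>2"
    unfolding equilateral_def side_a_def side_b_def side_c_def fourier_triangle_def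
    by (simp add: dist_plane_point)
  also have "\<dots> \<longleftrightarrow> p = 0 \<and> q = 0"
    unfolding a b c by auto
  also have "\<dots> \<longleftrightarrow> u * cnj v = 0"
    by (simp add: complex_eq_iff p_def q_def)
  finally show ?thesis by simp
qed

text \<open>
  The eigenvalue of the normalised circulant matrix with first row \<open>(x, y, z)\<close> on the Fourier mode
  of \<open>u\<close>. Since the matrix is real, its eigenvalue on the mode of \<open>v\<close> is the conjugate.
\<close>

definition multiplier :: "real \<times> real \<times> real \<Rightarrow> complex" where
  "multiplier w = (case w of (x, y, z) \<Rightarrow>
     (of_real x + of_real y * omega + of_real z * cnj omega) / of_real (x + y + z))"

text \<open>Over the reals the linear relations between \<open>1\<close>, \<open>\<omega>\<close>, \<open>\<omega>\<^sup>2\<close> are the multiples of \<open>1 + \<omega> + \<omega>\<^sup>2 = 0\<close>.\<close>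

lemma multiplier_eq_0_iff:
  assumes "bary_sum w \<noteq> 0"
  shows "multiplier w = 0 \<longleftrightarrow> all_equal w"
proof -
  obtain x y z where w: "w = (x, y, z)" by (metis prod_cases3)
  have "multiplier w = 0 \<longleftrightarrow> of_real x + of_real y * omega + of_real z * cnj omega = 0"
    using assms by (simp add: multiplier_def w bary_sum_def flip: of_real_add)
  also have "\<dots> \<longleftrightarrow> x = y \<and> y = z"
    by (auto simp: complex_eq_iff omega_def)
  finally show ?thesis by (simp add: w all_equal_def)
qed

lemma family_triangle_fourier:
  assumes "bary_sum (\<Psi> t) \<noteq> 0"
  shows "family_triangle \<Psi> (fourier_triangle g u v) t =
    fourier_triangle g (multiplier (\<Psi> t) * u) (cnj (multiplier (\<Psi> t)) * v)"
proof -
  obtain x y z where w: "\<Psi> t = (x, y, z)" by (metis prod_cases3)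
  have bary: "bary_point (x, y, z) (plane_point a, plane_point b, plane_point c) =
      plane_point ((of_real x * a + of_real y * b + of_real z * c) / of_real (x + y + z))"
    for x y z a b c
    unfolding bary_point_def prod.case plane_point_scaleR [symmetric] plane_point_add [symmetric]
    by (simp add: scaleR_conv_of_real)
  define n where "n = of_real x + of_real y * omega + of_real z * cnj omega"
  define s where "s = complex_of_real (x + y + z)"
  have s: "s \<noteq> 0"
    using assms by (simp add: w bary_sum_def s_def flip: of_real_add)
  have cn: "cnj n = of_real x + of_real y * cnj omega + of_real z * omega"
    by (simp add: n_def)
  have perm: "z + x + y = x + y + z" "y + z + x = x + y + z" by simp_all
  have quot: "(s * g + p * (n * u) + q * (cnj n * v)) / s = g + p * (n / s * u) + q * (cnj n / s * v)"
    for p q using s by (simp add: add_divide_distrib)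
  have A: "of_real x * (g + u + v) + of_real y * (g + omega * u + cnj omega * v)
      + of_real z * (g + cnj omega * u + omega * v) = s * g + 1 * (n * u) + 1 * (cnj n * v)"
    unfolding cn unfolding n_def s_def by (simp add: algebra_simps)
  have B: "of_real z * (g + u + v) + of_real x * (g + omega * u + cnj omega * v)
      + of_real y * (g + cnj omega * u + omega * v)
      = s * g + omega * (n * u) + cnj omega * (cnj n * v)"
    unfolding cn unfolding n_def s_def cnj_omega of_real_add using omega_power2 by algebra
  have C: "of_real y * (g + u + v) + of_real z * (g + omega * u + cnj omega * v)
      + of_real x * (g + cnj omega * u + omega * v)
      = s * g + cnj omega * (n * u) + omega * (cnj n * v)"
    unfolding cn unfolding n_def s_def cnj_omega of_real_add using omega_power2 by algebra
  have m: "multiplier (\<Psi> t) = n / s" and cnj_s: "cnj s = s"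
    by (simp_all add: multiplier_def w n_def s_def)
  show ?thesis
    unfolding family_triangle_def w prod.case fourier_triangle_def bary perm s_def [symmetric] A B C quot
    by (simp add: m w [symmetric] cnj_s)
qed

lemma bary_sum_concatenation:
  "bary_sum (concatenation \<Psi> \<Phi> t) = bary_sum (\<Psi> t) * bary_sum (\<Phi> t)"
  by (simp add: bary_sum_def concatenation_def algebra_simps split: prod.splits)

text \<open>
  Concatenation is the product of the circulant matrices, hence of their eigenvalues.
\<close>

lemma multiplier_concatenation:
  "multiplier (concatenation \<Psi> \<Phi> t) = multiplier (\<Psi> t) * multiplier (\<Phi> t)"
proof -
  obtain x y z where w: "\<Psi> t = (x, y, z)" by (metis prod_cases3)
  obtain x' y' z' where w': "\<Phi> t = (x', y', z')" by (metis prod_cases3)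
  have num: "(of_real x + of_real y * omega + of_real z * cnj omega) *
        (of_real x' + of_real y' * omega + of_real z' * cnj omega) =
      of_real (x * x' + y * z' + z * y') + of_real (x * y' + y * x' + z * z') * omega
        + of_real (x * z' + y * y' + z * x') * cnj omega"
    unfolding cnj_omega of_real_add of_real_mult using omega_power2 by algebra
  have den: "(x + y + z) * (x' + y' + z') =
      (x * x' + y * z' + z * y') + (x * y' + y * x' + z * z') + (x * z' + y * y' + z * x')"
    by (simp add: algebra_simps)
  show ?thesis
    unfolding multiplier_def w w' concatenation_def prod.case
    unfolding num [symmetric] den [symmetric] by (simp add: times_divide_times_eq)
qed

section \<open>Triangle centers relative to the centroid\<close>

definition reflected :: "triangle \<Rightarrow> triangle" where
  "reflected \<Delta> = (case \<Delta> of (A, B, C) \<Rightarrow>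
     (plane_point (cnj (plane_coord A)), plane_point (cnj (plane_coord B)),
      plane_point (cnj (plane_coord C))))"

lemma reflected_fourier_triangle:
  "reflected (fourier_triangle g u v) = fourier_triangle (cnj g) (cnj v) (cnj u)"
  by (simp add: reflected_def fourier_triangle_def algebra_simps)

lemma center_weights_reflected: "center_weights \<psi> (reflected \<Delta>) = center_weights \<psi> \<Delta>"
proof -
  have d: "dist (plane_point (cnj (plane_coord P))) (plane_point (cnj (plane_coord Q))) = dist P Q"
    for P Q
    by (metis complex_cnj_diff complex_mod_cnj dist_plane_point plane_point_coord)
  show ?thesis
    by (simp add: center_weights_def side_a_def side_b_def side_c_def reflected_def d
        split: prod.splits)
qed

lemma center_reflected:
  "center \<psi> (reflected \<Delta>) = plane_point (cnj (plane_coord (center \<psi> \<Delta>)))"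
  unfolding center_def center_weights_reflected
  by (simp add: bary_point_def reflected_def plane_point_def plane_coord_def vec_eq_iff forall_2
      add_divide_distrib diff_divide_distrib split: prod.splits)

definition center_offset :: "(real \<Rightarrow> real \<Rightarrow> real \<Rightarrow> real) \<Rightarrow> complex \<Rightarrow> complex \<Rightarrow> complex \<Rightarrow> complex" where
  "center_offset \<psi> g u v = plane_coord (center \<psi> (fourier_triangle g u v)) - g"

lemma center_offset_reflected:
  "center_offset \<psi> (cnj g) (cnj v) (cnj u) = cnj (center_offset \<psi> g u v)"
  unfolding center_offset_def reflected_fourier_triangle [symmetric] center_reflected by simp

lemma center_offset_nonzero:
  assumes "essentially_different_from_centroid \<psi>"
    and "center_defined \<psi> (fourier_triangle g u v)"
    and "u \<noteq> 0" "v \<noteq> 0" "cmod u \<noteq> cmod v"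
  shows "center_offset \<psi> g u v \<noteq> 0"
proof
  assume "center_offset \<psi> g u v = 0"
  then have "center \<psi> (fourier_triangle g u v) = centroid (fourier_triangle g u v)"
    by (metis center_offset_def centroid_fourier_triangle eq_iff_diff_eq_0 plane_point_coord)
  then show False
    using assms unfolding essentially_different_from_centroid_def
    by (metis equilateral_fourier_triangle nondegenerate_fourier_triangle)
qed

lemma triangle_curve_fourier:
  assumes "bary_sum (\<Psi> t) \<noteq> 0" "multiplier (\<Psi> t) \<noteq> 0"
  shows "triangle_curve \<psi> \<Psi> (fourier_triangle g u v) t =
    plane_point (g + center_offset \<psi> g (multiplier (\<Psi> t) * u) (cnj (multiplier (\<Psi> t)) * v))"
  using assms
  by (simp add: triangle_curve_def multiplier_eq_0_iff family_triangle_fourier center_offset_def)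

lemma exists_nonzero_multiplier:
  assumes "triangle_family \<Psi>"
  obtains t where "multiplier (\<Psi> t) \<noteq> 0"
  using assms that unfolding triangle_family_def by (metis multiplier_eq_0_iff)

text \<open>
  A family acts by a bijection of the nondegenerate nonequilateral triangles at each time when
  its multiplier is nonzero, so each such triangle lies on a curve along which the center is
  defined.
\<close>

lemma invariant_imp_center_defined:
  assumes "triangle_family \<Psi>" "invariant_curve_generating \<psi> \<Psi>"
    and "u \<noteq> 0" "v \<noteq> 0" "cmod u \<noteq> cmod v"
  shows "center_defined \<psi> (fourier_triangle g u v)"
proof -
  obtain t where t: "multiplier (\<Psi> t) \<noteq> 0"
    using exists_nonzero_multiplier assms(1) .
  define m where "m = multiplier (\<Psi> t)"
  have s: "bary_sum (\<Psi> t) \<noteq> 0" using assms(1) by (simp add: triangle_family_def)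
  let ?\<Delta> = "fourier_triangle g (u / m) (v / cnj m)"
  have "nondegenerate ?\<Delta> \<and> \<not> equilateral ?\<Delta>"
    using assms t
    by (simp add: nondegenerate_fourier_triangle equilateral_fourier_triangle m_def norm_divide)
  then have "curve_defined \<psi> \<Psi> ?\<Delta> t"
    using assms(2) unfolding invariant_curve_generating_def by blast
  then have "center_defined \<psi> (family_triangle \<Psi> ?\<Delta> t)"
    using t s by (simp add: curve_defined_def multiplier_eq_0_iff)
  then show ?thesis
    using t s by (simp add: family_triangle_fourier m_def)
qed

section \<open>The orientation-preserving form of invariance\<close>

text \<open>The positively oriented nonequilateral triangles, given by Fourier coordinates.\<close>

definition positive_triangles :: "(complex \<times> complex \<times> complex) set" where
  "positive_triangles = {(g, u, v). v \<noteq> 0 \<and> cmod v < cmod u}"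

text \<open>
  In the coordinates \<open>g\<close>, \<open>u\<close>, \<open>v / u\<close> this set is a product of connected sets: the plane, the
  punctured plane and the punctured unit disc.
\<close>

lemma connected_positive_triangles: "connected positive_triangles"
proof -
  let ?f = "\<lambda>(g :: complex, u :: complex, w). (g, u, u * w)"
  have "positive_triangles = ?f ` (UNIV \<times> (- {0}) \<times> (ball 0 1 - {0}))"
  proof (intro equalityI subsetI)
    fix x assume "x \<in> positive_triangles"
    then obtain g u v where x: "x = (g, u, v)" and "v \<noteq> 0" "cmod v < cmod u"
      by (auto simp: positive_triangles_def)
    then have "u \<noteq> 0" by auto
    then have "x = ?f (g, u, v / u)" "(g, u, v / u) \<in> UNIV \<times> (- {0}) \<times> (ball 0 1 - {0})"
      using x \<open>v \<noteq> 0\<close> \<open>cmod v < cmod u\<close> by (auto simp: norm_divide)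
    then show "x \<in> ?f ` (UNIV \<times> (- {0}) \<times> (ball 0 1 - {0}))" by blast
  next
    fix x assume "x \<in> ?f ` (UNIV \<times> (- {0}) \<times> (ball 0 1 - {0}))"
    then show "x \<in> positive_triangles"
      by (auto simp: positive_triangles_def norm_mult)
  qed
  moreover have "connected (?f ` (UNIV \<times> (- {0}) \<times> (ball 0 1 - {0})))"
    unfolding case_prod_unfold
    by (intro connected_continuous_image continuous_intros connected_Times connected_UNIV
        connected_punctured_universe connected_punctured_ball) simp_all
  ultimately show ?thesis by simp
qed

lemma continuous_on_center_offset:
  assumes "continuous_center \<psi>"
    and "\<And>g u v. u \<noteq> 0 \<Longrightarrow> v \<noteq> 0 \<Longrightarrow> cmod u \<noteq> cmod v \<Longrightarrow> center_defined \<psi> (fourier_triangle g u v)"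
    and "m \<noteq> 0"
  shows "continuous_on positive_triangles (\<lambda>(g, u, v). center_offset \<psi> g (m * u) (cnj m * v))"
proof -
  have [continuous_intros]: "continuous_on S (\<lambda>x. plane_point (f x))"
    if "continuous_on S f" for S :: "(complex \<times> complex \<times> complex) set" and f
    using linear_continuous_on_compose [OF that linear_plane_point] .
  have coord: "continuous_on UNIV plane_coord"
    using linear_continuous_on linear_conv_bounded_linear linear_plane_coord by blast
  let ?T = "\<lambda>(g, u, v). fourier_triangle g (m * u) (cnj m * v)"
  have "continuous_on positive_triangles ?T"
    unfolding fourier_triangle_def case_prod_unfold by (intro continuous_intros)
  moreover have "?T ` positive_triangles
      \<subseteq> {\<Delta>. nondegenerate \<Delta> \<and> \<not> equilateral \<Delta> \<and> center_defined \<psi> \<Delta>}"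
    unfolding image_subset_iff using assms(3)
    by (auto simp: positive_triangles_def nondegenerate_fourier_triangle
        equilateral_fourier_triangle norm_mult intro!: assms(2))
  ultimately have "continuous_on positive_triangles (\<lambda>x. center \<psi> (?T x))"
    using assms(1) continuous_on_compose2 unfolding continuous_center_def by blast
  then have "continuous_on positive_triangles (\<lambda>x. plane_coord (center \<psi> (?T x)) - fst x)"
    by (intro continuous_intros continuous_on_compose2 [OF coord]) auto
  then show ?thesis by (simp add: case_prod_unfold center_offset_def)
qed

text \<open>
  This removes the reflections from the definition of invariance. A priori the similarity of each
  triangle may or may not preserve orientation, and which case occurs could vary with the triangle,
  so that similarities for two families could not be combined. Among positively
  oriented triangles continuity of the center excludes this.
\<close>

lemma invariant_imp_constant_ratio:
  assumes cont: "continuous_center \<psi>" and diff: "essentially_different_from_centroid \<psi>"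
    and fam: "triangle_family \<Psi>" and inv: "invariant_curve_generating \<psi> \<Psi>"
  obtains c :: "real \<Rightarrow> complex" and \<mu> where "\<mu> \<noteq> 0"
    and "\<And>t g u v. multiplier (\<Psi> t) \<noteq> 0 \<Longrightarrow> v \<noteq> 0 \<Longrightarrow> cmod v < cmod u \<Longrightarrow>
      center_offset \<psi> g (multiplier (\<Psi> t) * u) (cnj (multiplier (\<Psi> t)) * v) =
        c t * center_offset \<psi> g (\<mu> * u) (cnj \<mu> * v)"
proof -
  obtain t0 where t0: "multiplier (\<Psi> t0) \<noteq> 0"
    using exists_nonzero_multiplier fam .
  define m where "m t = multiplier (\<Psi> t)" for t
  define Y where "Y t = (\<lambda>(g, u, v). center_offset \<psi> g (m t * u) (cnj (m t) * v))" for t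
  have sum: "bary_sum (\<Psi> t) \<noteq> 0" for t using fam by (simp add: triangle_family_def)
  have "\<exists>c. \<forall>x\<in>positive_triangles. Y t x = c * Y t0 x" if t: "m t \<noteq> 0" for t
  proof -
    have Y0: "Y t0 x \<noteq> 0" if pos: "x \<in> positive_triangles" for x
    proof -
      obtain g u v where x: "x = (g, u, v)" and uv: "v \<noteq> 0" "cmod v < cmod u"
        using pos by (auto simp: positive_triangles_def)
      then have "m t0 * u \<noteq> 0" "cnj (m t0) * v \<noteq> 0" "cmod (m t0 * u) \<noteq> cmod (cnj (m t0) * v)"
        using t0 by (auto simp: m_def norm_mult)
      then show ?thesis
        using center_offset_nonzero [OF diff] invariant_imp_center_defined [OF fam inv]
        by (simp add: Y_def x)
    qed
    obtain l where l: "\<forall>\<Delta>. nondegenerate \<Delta> \<and> \<not> equilateral \<Delta> \<longrightarrow>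
        (\<exists>S. linear_similarity S \<and> (\<forall>t. curve_defined \<psi> \<Psi> \<Delta> t \<and>
          triangle_curve \<psi> \<Psi> \<Delta> t = centroid \<Delta> + S (l t)))"
      using inv unfolding invariant_curve_generating_def by (rule exE)
    define q where "q = plane_coord (l t) / plane_coord (l t0)"
    \<comment> \<open>\<open>q\<close> occurs for a direct similarity, its conjugate for an opposite one.\<close>
    have two_values: "Y t x / Y t0 x \<in> {q, cnj q}" if pos: "x \<in> positive_triangles" for x
    proof -
      obtain g u v where x: "x = (g, u, v)" and uv: "v \<noteq> 0" "cmod v < cmod u"
        using pos by (auto simp: positive_triangles_def)
      have u: "u \<noteq> 0" using uv by auto
      obtain S where S: "linear_similarity S"
        and curve: "\<And>t. triangle_curve \<psi> \<Psi> (fourier_triangle g u v) t = plane_point g + S (l t)"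
        using l [rule_format, of "fourier_triangle g u v"] uv u
        unfolding nondegenerate_fourier_triangle equilateral_fourier_triangle
          centroid_fourier_triangle by auto
      obtain k where k: "k \<noteq> 0"
        "(\<forall>z. S (plane_point z) = plane_point (k * z)) \<or>
         (\<forall>z. S (plane_point z) = plane_point (k * cnj z))"
        using linear_similarity_plane_cases [OF S] by blast
      have SY: "S (l t') = plane_point (Y t' x)" if "m t' \<noteq> 0" for t'
        using curve [of t'] triangle_curve_fourier [of \<Psi> t', OF sum] that
        by (simp add: Y_def m_def x plane_point_add)
      have "Y t x = k * plane_coord (l t) \<and> Y t0 x = k * plane_coord (l t0) \<or>
            Y t x = k * cnj (plane_coord (l t)) \<and> Y t0 x = k * cnj (plane_coord (l t0))"
        using k(2) SY [OF t] SY [of t0] t0 by (metis m_def plane_coord_point plane_point_coord)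
      then show ?thesis using k(1) by (auto simp: q_def)
    qed
    have "continuous_on positive_triangles (Y t')" if "m t' \<noteq> 0" for t'
      unfolding Y_def using that
      by (intro continuous_on_center_offset [OF cont] invariant_imp_center_defined [OF fam inv])
    then have "continuous_on positive_triangles (\<lambda>x. Y t x / Y t0 x)"
      using t t0 Y0 by (intro continuous_intros) (auto simp: m_def)
    moreover have "finite ((\<lambda>x. Y t x / Y t0 x) ` positive_triangles)"
      by (rule finite_subset [of _ "{q, cnj q}"]) (use two_values in auto)
    ultimately have "(\<lambda>x. Y t x / Y t0 x) constant_on positive_triangles"
      by (rule continuous_finite_range_constant [OF connected_positive_triangles])
    then obtain c where "\<And>x. x \<in> positive_triangles \<Longrightarrow> Y t x / Y t0 x = c"
      unfolding constant_on_def by blast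
    then show ?thesis using Y0 by (metis nonzero_divide_eq_eq)
  qed
  then obtain c where c: "\<And>t x. m t \<noteq> 0 \<Longrightarrow> x \<in> positive_triangles \<Longrightarrow> Y t x = c t * Y t0 x"
    by metis
  show thesis
  proof (rule that)
    show "m t0 \<noteq> 0" using t0 by (simp add: m_def)
    fix t g u v
    assume "multiplier (\<Psi> t) \<noteq> 0" "v \<noteq> 0" "cmod v < cmod u"
    then show "center_offset \<psi> g (multiplier (\<Psi> t) * u) (cnj (multiplier (\<Psi> t)) * v) =
        c t * center_offset \<psi> g (m t0 * u) (cnj (m t0) * v)"
      using c [of t "(g, u, v)"] by (simp add: Y_def m_def positive_triangles_def)
  qed
qed

section \<open>Invariance under concatenation\<close>

theorem lemma12:
  fixes \<psi> :: "real \<Rightarrow> real \<Rightarrow> real \<Rightarrow> real"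
    and \<Psi>0 \<Psi>1 :: family
  assumes "triangle_center_function \<psi>"
    and "continuous_center \<psi>"
    and "essentially_different_from_centroid \<psi>"
    and "triangle_family \<Psi>0"
    and "triangle_family \<Psi>1"
    and "invariant_curve_generating \<psi> \<Psi>0"
    and "invariant_curve_generating \<psi> \<Psi>1"
  shows "invariant_curve_generating \<psi> (concatenation \<Psi>1 \<Psi>0)"
proof -
  let ?\<Psi> = "concatenation \<Psi>1 \<Psi>0"
  let ?m = "\<lambda>t. multiplier (?\<Psi> t)"
  obtain c0 \<mu>0 where \<mu>0: "\<mu>0 \<noteq> 0"
    and c0: "\<And>t g u v. multiplier (\<Psi>0 t) \<noteq> 0 \<Longrightarrow> v \<noteq> 0 \<Longrightarrow> cmod v < cmod u \<Longrightarrow>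
      center_offset \<psi> g (multiplier (\<Psi>0 t) * u) (cnj (multiplier (\<Psi>0 t)) * v) =
        c0 t * center_offset \<psi> g (\<mu>0 * u) (cnj \<mu>0 * v)"
    using invariant_imp_constant_ratio [OF assms(2,3,4,6)] by metis
  obtain c1 \<mu>1 where \<mu>1: "\<mu>1 \<noteq> 0"
    and c1: "\<And>t g u v. multiplier (\<Psi>1 t) \<noteq> 0 \<Longrightarrow> v \<noteq> 0 \<Longrightarrow> cmod v < cmod u \<Longrightarrow>
      center_offset \<psi> g (multiplier (\<Psi>1 t) * u) (cnj (multiplier (\<Psi>1 t)) * v) =
        c1 t * center_offset \<psi> g (\<mu>1 * u) (cnj \<mu>1 * v)"
    using invariant_imp_constant_ratio [OF assms(2,3,5,7)] by metis
  have sum: "bary_sum (?\<Psi> t) \<noteq> 0" for t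
    using assms(4,5) by (simp add: bary_sum_concatenation triangle_family_def)
  \<comment> \<open>Where the multiplier vanishes the triangle has shrunk to its centroid, so the curve is at 0.\<close>
  define l where "l t = (if ?m t = 0 then 0 else c1 t * c0 t)" for t
  have positive: "center_offset \<psi> g (?m t * u) (cnj (?m t) * v) =
      center_offset \<psi> g (\<mu>0 * (\<mu>1 * u)) (cnj \<mu>0 * (cnj \<mu>1 * v)) * l t"
    if "v \<noteq> 0" "cmod v < cmod u" "?m t \<noteq> 0" for t g u v
  proof -
    have nz: "multiplier (\<Psi>1 t) \<noteq> 0" "multiplier (\<Psi>0 t) \<noteq> 0"
      using that(3) by (auto simp: multiplier_concatenation)
    have "center_offset \<psi> g (?m t * u) (cnj (?m t) * v) =
        center_offset \<psi> g (multiplier (\<Psi>1 t) * (multiplier (\<Psi>0 t) * u))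
          (cnj (multiplier (\<Psi>1 t)) * (cnj (multiplier (\<Psi>0 t)) * v))"
      by (simp add: multiplier_concatenation mult.assoc)
    also have "\<dots> = c1 t * center_offset \<psi> g (\<mu>1 * (multiplier (\<Psi>0 t) * u))
        (cnj \<mu>1 * (cnj (multiplier (\<Psi>0 t)) * v))"
      using nz that by (intro c1) (auto simp: norm_mult)
    \<comment> \<open>The two families commute, so the reference value \<open>\<mu>1\<close> can be absorbed into the triangle.\<close>
    also have "\<dots> = c1 t * center_offset \<psi> g (multiplier (\<Psi>0 t) * (\<mu>1 * u))
        (cnj (multiplier (\<Psi>0 t)) * (cnj \<mu>1 * v))"
      by (simp add: mult.left_commute)
    also have "\<dots> = c1 t * (c0 t * center_offset \<psi> g (\<mu>0 * (\<mu>1 * u)) (cnj \<mu>0 * (cnj \<mu>1 * v)))"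
      using nz that \<mu>1 by (subst c0) (auto simp: norm_mult)
    finally show ?thesis using that(3) by (simp add: l_def)
  qed
  have defined: "center_defined \<psi> (fourier_triangle g u v)"
    if "u \<noteq> 0" "v \<noteq> 0" "cmod u \<noteq> cmod v" for g u v
    using invariant_imp_center_defined [OF assms(4,6) that] .
  have nonzero: "center_offset \<psi> g (\<mu>0 * (\<mu>1 * u)) (cnj \<mu>0 * (cnj \<mu>1 * v)) \<noteq> 0"
    if "v \<noteq> 0" "cmod v < cmod u" for g u v
    using that \<mu>0 \<mu>1
    by (intro center_offset_nonzero [OF assms(3)] defined) (auto simp: norm_mult)
  have similarity: "\<exists>S. linear_similarity S \<and> (\<forall>t. ?m t \<noteq> 0 \<longrightarrow>
        plane_point (center_offset \<psi> g (?m t * u) (cnj (?m t) * v)) = S (plane_point (l t)))"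
    if "u \<noteq> 0" "v \<noteq> 0" "cmod u \<noteq> cmod v" for g u v
  proof (cases "cmod v < cmod u")
    case True
    then show ?thesis
      using linear_similarity_mult [OF nonzero [OF that(2) True]] positive [OF that(2) True]
      by (intro exI conjI) auto
  next
    case False
    then have uv: "cnj u \<noteq> 0" "cmod (cnj u) < cmod (cnj v)" using that by auto
    \<comment> \<open>The mirror image has coordinates \<open>cnj g\<close>, \<open>cnj v\<close>, \<open>cnj u\<close> and is positively oriented.\<close>
    define k where "k = center_offset \<psi> (cnj g) (\<mu>0 * (\<mu>1 * cnj v)) (cnj \<mu>0 * (cnj \<mu>1 * cnj u))"
    have "center_offset \<psi> g (?m t * u) (cnj (?m t) * v) = cnj k * cnj (l t)"
      if "?m t \<noteq> 0" for t
    proof -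
      have "cnj (center_offset \<psi> g (?m t * u) (cnj (?m t) * v)) =
          center_offset \<psi> (cnj g) (?m t * cnj v) (cnj (?m t) * cnj u)"
        unfolding center_offset_reflected [symmetric] by simp
      also have "\<dots> = k * l t" unfolding k_def using positive uv that by blast
      finally show ?thesis by (metis complex_cnj_cnj complex_cnj_mult)
    qed
    moreover have "linear_similarity (\<lambda>p. plane_point (cnj k * cnj (plane_coord p)))"
      using linear_similarity_mult_cnj nonzero [OF uv] by (simp add: k_def)
    ultimately show ?thesis by (intro exI conjI) auto
  qed
  show ?thesis
    unfolding invariant_curve_generating_def
  proof (intro exI [of _ "\<lambda>t. plane_point (l t)"] allI impI)
    fix \<Delta> assume \<Delta>: "nondegenerate \<Delta> \<and> \<not> equilateral \<Delta>"
    obtain g u v where T: "\<Delta> = fourier_triangle g u v" by (rule fourier_triangle_exhaust)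
    have uv: "u \<noteq> 0" "v \<noteq> 0" "cmod u \<noteq> cmod v"
      using \<Delta> by (simp_all add: T nondegenerate_fourier_triangle equilateral_fourier_triangle)
    obtain S where S: "linear_similarity S" and eq: "\<And>t. ?m t \<noteq> 0 \<Longrightarrow>
        plane_point (center_offset \<psi> g (?m t * u) (cnj (?m t) * v)) = S (plane_point (l t))"
      using similarity [OF uv] by blast
    have S0: "S (plane_point 0) = 0"
      using linear_similarity_plane_cases [OF S]
      by (metis complex_cnj_zero mult_zero_right plane_point_0)
    have "curve_defined \<psi> ?\<Psi> \<Delta> t \<and> triangle_curve \<psi> ?\<Psi> \<Delta> t = centroid \<Delta> + S (plane_point (l t))"
      for t
    proof (cases "?m t = 0")
      case True
      then show ?thesis
        using sum S0
        by (simp add: multiplier_eq_0_iff curve_defined_def triangle_curve_def l_def)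
    next
      case False
      have "curve_defined \<psi> ?\<Psi> \<Delta> t"
        using False uv unfolding curve_defined_def T family_triangle_fourier [OF sum]
        by (intro disjI2 defined) (auto simp: norm_mult)
      then show ?thesis
        using eq [OF False] unfolding T triangle_curve_fourier [of ?\<Psi>, OF sum False]
          centroid_fourier_triangle by (simp add: plane_point_add)
    qed
    with S show "\<exists>S. linear_similarity S \<and> (\<forall>t. curve_defined \<psi> ?\<Psi> \<Delta> t \<and>
        triangle_curve \<psi> ?\<Psi> \<Delta> t = centroid \<Delta> + S (plane_point (l t)))" by blast
  qed
qed
end
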